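(* Let $\phi$ be a fan valuation on $\mathbf{Fans}_d$ with values in an abelian group, and let $\mathcal{A}$ be a hyperplane arrangement in a linear subspace of $\mathbb{R}^d$ which is not a singleton. Then for every $H\in\mathcal{A}$ \[ \phi(\mathcal{N}(\mathcal{A})) \ = \ \phi(\mathcal{N}(\mathcal{A}\backslash H)) + \phi(\mathcal{N}(\mathcal{A}/H)) \, . \]
   Context: Polyhedral cones are nonempty and contain the origin. For a cone $C$, $\mathrm{lin}(C)$ is its linear hull and $\mathrm{relint}(C)$ its relative interior. A fan in $\mathbb{R}^d$ is a finite collection $\mathcal{N}$ of polyhedral cones in $\mathbb{R}^d$ such that for all $C,C'\in\mathcal{N}$: (i) $C\cap C'$ is a face of $C$, and (ii) $\mathrm{lin}(C)=\mathrm{lin}(C')$; this common linear hull is denoted $\mathrm{lin}(\mathcal{N})$. $\mathbf{Fans}_d$ is the set of all fans in $\mathbb{R}^d$, including the empty fan $\emptyset$. For a set $S\subseteq \mathrm{lin}(\mathcal{N})$ put $\mathcal{N}\cap S = \{C\cap S : C\in\mathcal{N},\ \mathrm{relint}(C)\cap S\neq\emptyset\}$. A map $\phi$ from $\mathbf{Fans}_d$ to an abelian group is a fan valuation if $\phi(\emptyset)=0$ and for every nonempty fan $\mathcal{N}\in\mathbf{Fans}_d$ and every linear hyperplane $H\subseteq\mathrm{lin}(\mathcal{N})$ (linear subspace of codimension 1 in $\mathrm{lin}(\mathcal{N})$) one has $\phi(\mathcal{N})=\phi(\mathcal{N}\cap H^{\le})+\phi(\mathcal{N}\cap H^{\ge})-\phi(\mathcal{N}\cap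 H)$, where $H^{\le},H^{\ge}$ are the two closed halfspaces of $\mathrm{lin}(\mathcal{N})$ bounded by $H$. A hyperplane arrangement $\mathcal{A}$ is a finite collection of linear hyperplanes in some linear subspace $L\subseteq\mathbb{R}^d$. The closures of the connected components of $L\setminus\bigcup\mathcal{A}$ form a fan $\mathcal{N}(\mathcal{A})$. A singleton is an arrangement consisting of a single hyperplane. For $H\in\mathcal{A}$, the deletion is $\mathcal{A}\backslash H=\{H'\in\mathcal{A}:H'\ne H\}$ (an arrangement in $L$) and the restriction is $\mathcal{A}/H=\{H'\cap H : H'\in\mathcal{A},H'\neq H\}$ (an arrangement in $H$). *)

theory Defs
  imports "HOL-Analysis.Analysis"
begin

definition polyhedral_cone :: "(real^'d) set \<Rightarrow> bool" where
  "polyhedral_cone C \<longleftrightarrow> polyhedron C \<and> cone C \<and> C \<noteq> {}"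

definition fan :: "(real^'d) set set \<Rightarrow> bool" where
  "fan N \<longleftrightarrow> finite N \<and> (\<forall>C\<in>N. polyhedral_cone C) \<and>
     (\<forall>C\<in>N. \<forall>C'\<in>N. (C \<inter> C') face_of C \<and> span C = span C')"

(* Only meaningful for nonempty fans, where it is the common linear hull (lin_fan_eq). *)
definition lin_fan :: "(real^'d) set set \<Rightarrow> (real^'d) set" where
  "lin_fan N = span (\<Union>N)"

lemma lin_fan_eq:
  assumes "fan N" "C \<in> N"
  shows "lin_fan N = span C"
proof (rule subset_antisym)
  have "\<Union>N \<subseteq> span C"
    using assms unfolding fan_def by (metis Union_least span_superset)
  then show "lin_fan N \<subseteq> span C"
    unfolding lin_fan_def by (simp add: span_minimal)
  show "span C \<subseteq> lin_fan N"
    unfolding lin_fan_def using assms(2) by (intro span_mono) blast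
qed

definition fan_inter :: "(real^'d) set set \<Rightarrow> (real^'d) set \<Rightarrow> (real^'d) set set" where
  "fan_inter N S = {C \<inter> S | C. C \<in> N \<and> rel_interior C \<inter> S \<noteq> {}}"

definition hyperplane_of :: "(real^'d) set \<Rightarrow> (real^'d) set \<Rightarrow> bool" where
  "hyperplane_of L H \<longleftrightarrow> subspace H \<and> H \<subseteq> L \<and> dim L = dim H + 1"

(* phi is total on sets of sets; its values outside fans are irrelevant, since all its
   arguments below are fans. The two closed halfspaces of lin_fan N bounded by H are given by
   a normal vector u of H in lin_fan N, which is unique up to a nonzero factor. *)
definition fan_valuation :: "((real^'d) set set \<Rightarrow> 'g::ab_group_add) \<Rightarrow> bool" where
  "fan_valuation \<phi> \<longleftrightarrow> \<phi> {} = 0 \<and>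
     (\<forall>N H u. fan N \<and> N \<noteq> {} \<and> hyperplane_of (lin_fan N) H \<and>
        u \<in> lin_fan N \<and> H = {x \<in> lin_fan N. u \<bullet> x = 0} \<longrightarrow>
        \<phi> N = \<phi> (fan_inter N {x \<in> lin_fan N. u \<bullet> x \<le> 0})
             + \<phi> (fan_inter N {x \<in> lin_fan N. u \<bullet> x \<ge> 0})
             - \<phi> (fan_inter N H))"

definition arrangement :: "(real^'d) set \<Rightarrow> (real^'d) set set \<Rightarrow> bool" where
  "arrangement L A \<longleftrightarrow> subspace L \<and> finite A \<and> (\<forall>H\<in>A. hyperplane_of L H)"

(* The ambient subspace L is an explicit argument, as it cannot be recovered from A = {}. *)
definition arrangement_fan :: "(real^'d) set \<Rightarrow> (real^'d) set set \<Rightarrow> (real^'d) set set" where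
  "arrangement_fan L A = closure ` components (L - \<Union>A)"

definition deletion :: "(real^'d) set set \<Rightarrow> (real^'d) set \<Rightarrow> (real^'d) set set" where
  "deletion A H = {H' \<in> A. H' \<noteq> H}"

definition restriction :: "(real^'d) set set \<Rightarrow> (real^'d) set \<Rightarrow> (real^'d) set set" where
  "restriction A H = {H' \<inter> H | H'. H' \<in> A \<and> H' \<noteq> H}"

end

theory Submission imports Defs begin

text \<open>
  Cut both \<open>\<N>(\<A>)\<close> and \<open>\<N>(\<A>\H)\<close> along \<open>H\<close>. The halves agree: a cone of \<open>\<N>(\<A>\H)\<close> whose
  relative interior meets the closed halfspace \<open>H\<^sup>\<le>\<close> also has interior points strictly inside it,
  so its part in \<open>H\<^sup>\<le>\<close> is again the closure of a region of \<open>\<A>\<close>, and every region of \<open>\<A>\<close> in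
  \<open>H\<^sup>\<le>\<close> arises in this way (lemma \<open>fan_inter_halfspace\<close>). The cuts with \<open>H\<close> itself differ: no
  region of \<open>\<A>\<close> meets \<open>H\<close>, whereas the regions of \<open>\<A>\H\<close> that meet \<open>H\<close> cut out exactly the
  regions of \<open>\<A>/H\<close> (lemma \<open>fan_inter_hyperplane\<close>). Subtracting the two instances of the valuation
  property therefore leaves \<open>\<phi>(\<N>(\<A>)) - \<phi>(\<N>(\<A>\H)) = \<phi>(\<N>(\<A>/H)) - \<phi>(\<emptyset>)\<close>.

  To compare the three fans it is convenient to describe an arrangement in \<open>L\<close> by a finite set \<open>V\<close>
  of normal vectors that need not lie in \<open>L\<close>. Then \<open>\<A>\H\<close> and \<open>\<A>/H\<close> have the same \<open>V\<close> and differ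
  only in the ambient subspace. A region is the set of points of \<open>L\<close> on which every \<open>v \<in> V\<close> has
  the same sign as at a given point \<open>x\<close>, and its closure is described by the corresponding weak
  inequalities, whence polyhedrality, relative interiors and faces can be read off.
\<close>

section \<open>Chambers cut out by a set of normal vectors\<close>

definition generic :: "'a::euclidean_space set \<Rightarrow> 'a set \<Rightarrow> 'a set" where
  "generic L V = {x \<in> L. \<forall>v\<in>V. v \<bullet> x \<noteq> 0}"

text \<open>A positive product says that \<open>v\<close> has the same nonzero sign at \<open>x\<close> and \<open>y\<close>.\<close>

definition chamber :: "'a::euclidean_space set \<Rightarrow> 'a set \<Rightarrow> 'a \<Rightarrow> 'a set" where
  "chamber L V x = {y \<in> L. \<forall>v\<in>V. 0 < (v \<bullet> x) * (v \<bullet> y)}"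

definition closed_chamber :: "'a::euclidean_space set \<Rightarrow> 'a set \<Rightarrow> 'a \<Rightarrow> 'a set" where
  "closed_chamber L V x = {y \<in> L. \<forall>v\<in>V. 0 \<le> (v \<bullet> x) * (v \<bullet> y)}"

definition chamber_fan :: "'a::euclidean_space set \<Rightarrow> 'a set \<Rightarrow> 'a set set" where
  "chamber_fan L V = closed_chamber L V ` generic L V"

lemma mem_chamber_self: "x \<in> generic L V \<Longrightarrow> x \<in> chamber L V x"
  by (auto simp: generic_def chamber_def zero_less_mult_iff)

lemma chamber_subset_generic: "chamber L V x \<subseteq> generic L V"
  by (auto simp: generic_def chamber_def)

lemma chamber_subset_closed_chamber: "chamber L V x \<subseteq> closed_chamber L V x"
  by (auto simp: chamber_def closed_chamber_def intro: less_imp_le)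

lemma closed_chamber_eq:
  assumes "y \<in> chamber L V x"
  shows "closed_chamber L V y = closed_chamber L V x"
proof -
  have "0 \<le> (v \<bullet> y) * (v \<bullet> z) \<longleftrightarrow> 0 \<le> (v \<bullet> x) * (v \<bullet> z)" if "v \<in> V" for v z
  proof -
    have "0 < (v \<bullet> x) * (v \<bullet> y)"
      using assms that by (simp add: chamber_def)
    then show ?thesis
      unfolding zero_le_mult_iff zero_less_mult_iff by linarith
  qed
  then show ?thesis
    by (simp add: closed_chamber_def cong: ball_cong)
qed

lemma closed_chamber_insert:
  "closed_chamber L (insert u V) x = closed_chamber L V x \<inter> {y \<in> L. 0 \<le> (u \<bullet> x) * (u \<bullet> y)}"
  by (auto simp: closed_chamber_def)

lemma convex_chamber:
  assumes "subspace L"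
  shows "convex (chamber L V x)"
proof -
  have "chamber L V x = L \<inter> (\<Inter>v\<in>V. {y. ((v \<bullet> x) *\<^sub>R v) \<bullet> y > 0})"
    by (auto simp: chamber_def)
  then show ?thesis
    using assms
    by (simp del: inner_scaleR_left
        add: convex_Int convex_INT convex_halfspace_gt subspace_imp_convex)
qed

lemma openin_chamber:
  assumes "finite V"
  shows "openin (top_of_set L) (chamber L V x)"
proof -
  have "chamber L V x = L \<inter> (\<Inter>v\<in>V. {y. ((v \<bullet> x) *\<^sub>R v) \<bullet> y > 0})"
    by (auto simp: chamber_def)
  moreover have "open (\<Inter>v\<in>V. {y. ((v \<bullet> x) *\<^sub>R v) \<bullet> y > 0})"
    using assms by (intro open_INT) (auto simp del: inner_scaleR_left intro: open_halfspace_gt)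
  ultimately show ?thesis
    by (metis openin_open)
qed

lemma polyhedron_closed_chamber:
  assumes "subspace L" "finite V"
  shows "polyhedron (closed_chamber L V x)"
proof -
  have "closed_chamber L V x = L \<inter> \<Inter>((\<lambda>v. {y. ((v \<bullet> x) *\<^sub>R v) \<bullet> y \<ge> 0}) ` V)"
    by (auto simp: closed_chamber_def)
  moreover have "polyhedron (\<Inter>((\<lambda>v. {y. ((v \<bullet> x) *\<^sub>R v) \<bullet> y \<ge> 0}) ` V))"
    using assms by (intro polyhedron_Inter) (auto simp del: inner_scaleR_left intro: polyhedron_halfspace_ge)
  moreover have "polyhedron L"
    using assms by (intro affine_imp_polyhedron subspace_imp_affine)
  ultimately show ?thesis
    by simp
qed

lemma cone_closed_chamber:
  assumes "subspace L"
  shows "cone (closed_chamber L V x)"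
  using assms unfolding cone_def closed_chamber_def
  by (auto simp: subspace_scale mult.left_commute)

text \<open>Along a path that avoids the hyperplanes no \<open>v \<in> V\<close> changes sign, and conversely a chamber is
  convex; so the chambers are the connected components of the complement.\<close>

lemma components_generic:
  assumes "subspace L"
  shows "components (generic L V) = chamber L V ` generic L V"
proof -
  have "connected_component_set (generic L V) x = chamber L V x" if x: "x \<in> generic L V" for x
  proof
    show "chamber L V x \<subseteq> connected_component_set (generic L V) x"
      using assms x
      by (intro connected_component_maximal mem_chamber_self chamber_subset_generic
          convex_connected convex_chamber)
    show "connected_component_set (generic L V) x \<subseteq> chamber L V x"
    proof
      fix y assume "y \<in> connected_component_set (generic L V) x"
      then obtain T where T: "connected T" "T \<subseteq> generic L V" "x \<in> T" "y \<in> T"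
        by (auto simp: connected_component_def)
      have "0 < (v \<bullet> x) * (v \<bullet> y)" if "v \<in> V" for v
      proof (rule ccontr)
        assume "\<not> 0 < (v \<bullet> x) * (v \<bullet> y)"
        then have "v \<bullet> x \<le> 0 \<and> 0 \<le> v \<bullet> y \<or> v \<bullet> y \<le> 0 \<and> 0 \<le> v \<bullet> x"
          by (auto simp: zero_less_mult_iff)
        then obtain z where "z \<in> T" "v \<bullet> z = 0"
          using connected_ivt_hyperplane[OF T(1)] T(3,4) by metis
        then show False
          using T(2) that by (auto simp: generic_def)
      qed
      then show "y \<in> chamber L V x"
        using T by (auto simp: chamber_def generic_def)
    qed
  qed
  then show ?thesis
    by (auto simp: components_def)
qed

text \<open>A chamber is open in \<open>L\<close>, so it cannot lie in a proper affine subspace.\<close>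

lemma affine_hull_closed_chamber:
  assumes "subspace L" "finite V" "x \<in> generic L V"
  shows "affine hull closed_chamber L V x = L"
proof
  have L: "affine hull L = L"
    using assms(1) by (simp add: subspace_imp_affine)
  have "closed_chamber L V x \<subseteq> L"
    by (auto simp: closed_chamber_def)
  then show "affine hull closed_chamber L V x \<subseteq> L"
    using L hull_mono by metis
  have "affine hull chamber L V x = affine hull L"
    using openin_chamber[OF assms(2), of L x] mem_chamber_self[OF assms(3)]
    by (intro affine_hull_openin) (auto simp only: L)
  then show "L \<subseteq> affine hull closed_chamber L V x"
    using L hull_mono[OF chamber_subset_closed_chamber] by metis
qed

lemma span_closed_chamber:
  assumes "subspace L" "finite V" "x \<in> generic L V"
  shows "span (closed_chamber L V x) = L"
proof
  show "span (closed_chamber L V x) \<subseteq> L"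
    using assms(1) by (intro span_minimal) (auto simp: closed_chamber_def)
  show "L \<subseteq> span (closed_chamber L V x)"
    using affine_hull_closed_chamber[OF assms] affine_hull_subset_span by metis
qed

lemma rel_interior_closed_chamber:
  assumes "subspace L" "finite V" "x \<in> generic L V"
  shows "rel_interior (closed_chamber L V x) = chamber L V x"
proof
  show "chamber L V x \<subseteq> rel_interior (closed_chamber L V x)"
    using openin_chamber[OF assms(2)] affine_hull_closed_chamber[OF assms]
    by (intro rel_interior_maximal chamber_subset_closed_chamber) auto
  have x: "x \<in> closed_chamber L V x"
    using mem_chamber_self[OF assms(3)] chamber_subset_closed_chamber by blast
  show "rel_interior (closed_chamber L V x) \<subseteq> chamber L V x"
  proof
    fix y assume y: "y \<in> rel_interior (closed_chamber L V x)"
    \<comment> \<open>The segment from \<open>x\<close> to \<open>y\<close> can be prolonged beyond \<open>y\<close> inside the cone; a \<open>v \<in> V\<close>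
      that vanished at \<open>y\<close> would, being nonzero at \<open>x\<close>, have the wrong sign there.\<close>
    then obtain e where e: "e > 1" "(1 - e) *\<^sub>R x + e *\<^sub>R y \<in> closed_chamber L V x"
      using convex_rel_interior_iff[of "closed_chamber L V x" y] x
        polyhedron_imp_convex[OF polyhedron_closed_chamber[OF assms(1,2)]] by blast
    have "0 < (v \<bullet> x) * (v \<bullet> y)" if "v \<in> V" for v
    proof -
      have "0 \<le> (v \<bullet> x) * (v \<bullet> ((1 - e) *\<^sub>R x + e *\<^sub>R y))"
        using e(2) that by (auto simp: closed_chamber_def)
      then have "(e - 1) * (v \<bullet> x)\<^sup>2 \<le> e * ((v \<bullet> x) * (v \<bullet> y))"
        by (simp add: inner_add_right power2_eq_square algebra_simps)
      moreover have "0 < (e - 1) * (v \<bullet> x)\<^sup>2"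
        using e(1) assms(3) that by (simp add: generic_def)
      ultimately have "0 < e * ((v \<bullet> x) * (v \<bullet> y))"
        by linarith
      then show ?thesis
        using e(1) by (simp add: zero_less_mult_iff)
    qed
    moreover have "y \<in> L"
      using y rel_interior_subset by (force simp: closed_chamber_def)
    ultimately show "y \<in> chamber L V x"
      by (simp add: chamber_def)
  qed
qed

lemma closure_chamber:
  assumes "subspace L" "finite V" "x \<in> generic L V"
  shows "closure (chamber L V x) = closed_chamber L V x"
proof -
  have P: "polyhedron (closed_chamber L V x)"
    using assms by (intro polyhedron_closed_chamber)
  have "closure (chamber L V x) = closure (closed_chamber L V x)"
    using convex_closure_rel_interior[OF polyhedron_imp_convex[OF P]]
      rel_interior_closed_chamber[OF assms] by simp
  then show ?thesis
    using polyhedron_imp_closed[OF P] by simp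
qed

lemma closure_components_generic:
  assumes "subspace L" "finite V"
  shows "closure ` components (generic L V) = chamber_fan L V"
  using assms by (simp add: components_generic chamber_fan_def image_image closure_chamber)

text \<open>At a point of \<open>closed_chamber L V x \<inter> closed_chamber L V y\<close> every \<open>v\<close> whose signs at \<open>x\<close> and
  \<open>y\<close> are opposite vanishes. Such a \<open>v\<close> does not change sign on \<open>closed_chamber L V x\<close>, so if it
  vanishes inside a segment of this cone, then it vanishes at both endpoints.\<close>

lemma closed_chamber_Int_face_of:
  assumes "subspace L" "x \<in> generic L V" "y \<in> generic L V" "finite V"
  shows "(closed_chamber L V x \<inter> closed_chamber L V y) face_of closed_chamber L V x"
proof -
  have *: "0 \<le> (v \<bullet> y) * (v \<bullet> a)"
    if a: "a \<in> closed_chamber L V x" and b: "b \<in> closed_chamber L V x"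
      and p: "p \<in> closed_chamber L V y" "p \<in> open_segment a b" and v: "v \<in> V" for a b p v
  proof (cases "0 < (v \<bullet> x) * (v \<bullet> y)")
    case True
    moreover have "0 \<le> (v \<bullet> x) * (v \<bullet> a)"
      using a v by (simp add: closed_chamber_def)
    ultimately show ?thesis
      by (auto simp: zero_less_mult_iff zero_le_mult_iff)
  next
    case False
    have nz: "v \<bullet> x \<noteq> 0" "v \<bullet> y \<noteq> 0"
      using assms(2,3) v by (auto simp: generic_def)
    obtain t where t: "0 < t" "t < 1" "p = (1 - t) *\<^sub>R a + t *\<^sub>R b"
      using p(2) by (auto simp: in_segment)
    have "0 \<le> (v \<bullet> x) * (v \<bullet> a)" "0 \<le> (v \<bullet> x) * (v \<bullet> b)" "0 \<le> (v \<bullet> y) * (v \<bullet> p)"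
      using a b p v by (auto simp: closed_chamber_def)
    moreover have "v \<bullet> p = (1 - t) * (v \<bullet> a) + t * (v \<bullet> b)"
      using t(3) by (simp add: inner_add_right)
    moreover have "(0 < v \<bullet> x \<and> v \<bullet> y < 0) \<or> (v \<bullet> x < 0 \<and> 0 < v \<bullet> y)"
      using False nz by (auto simp: zero_less_mult_iff not_less)
    ultimately consider
      "0 \<le> v \<bullet> a" "0 \<le> v \<bullet> b" "(1 - t) * (v \<bullet> a) + t * (v \<bullet> b) \<le> 0"
      | "v \<bullet> a \<le> 0" "v \<bullet> b \<le> 0" "0 \<le> (1 - t) * (v \<bullet> a) + t * (v \<bullet> b)"
      by (auto simp: zero_le_mult_iff)
    then have "v \<bullet> a = 0"
    proof cases
      case 1
      then have "(1 - t) * (v \<bullet> a) \<le> 0"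
        using t mult_nonneg_nonneg[of t "v \<bullet> b"] by linarith
      then show ?thesis
        using 1(1) t by (simp add: mult_le_0_iff)
    next
      case 2
      then have "0 \<le> (1 - t) * (v \<bullet> a)"
        using t mult_nonneg_nonpos[of t "v \<bullet> b"] by linarith
      then show ?thesis
        using 2(1) t by (simp add: zero_le_mult_iff)
    qed
    then show ?thesis
      by simp
  qed
  have cvx: "convex (closed_chamber L V z)" for z
    using assms by (intro polyhedron_imp_convex polyhedron_closed_chamber)
  show ?thesis
    unfolding face_of_def
  proof (intro conjI ballI impI)
    fix a b p
    assume ab: "a \<in> closed_chamber L V x" "b \<in> closed_chamber L V x"
      and p: "p \<in> closed_chamber L V x \<inter> closed_chamber L V y" "p \<in> open_segment a b"
    have "p \<in> open_segment b a"
      using p(2) by (simp add: open_segment_commute)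
    then show "a \<in> closed_chamber L V x \<inter> closed_chamber L V y"
      "b \<in> closed_chamber L V x \<inter> closed_chamber L V y"
      using ab p *[of a b p] *[of b a p] by (auto simp: closed_chamber_def)
  qed (auto intro: convex_Int cvx)
qed

text \<open>A closed chamber is determined by the set of \<open>v \<in> V\<close> that are positive on the chamber.\<close>

lemma finite_chamber_fan:
  assumes "finite V"
  shows "finite (chamber_fan L V)"
proof -
  define D where "D P = {y \<in> L. (\<forall>v\<in>P. 0 \<le> v \<bullet> y) \<and> (\<forall>v\<in>V - P. v \<bullet> y \<le> 0)}" for P
  have "closed_chamber L V x = D {v \<in> V. 0 < v \<bullet> x}" if "x \<in> generic L V" for x
    using that by (fastforce simp: D_def closed_chamber_def generic_def zero_le_mult_iff)
  then have "chamber_fan L V \<subseteq> D ` Pow V"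
    by (auto simp: chamber_fan_def)
  then show ?thesis
    using assms by (meson finite_surj finite_Pow_iff)
qed

lemma fan_chamber_fan:
  fixes L :: "(real^'d) set"
  assumes "subspace L" "finite V"
  shows "fan (chamber_fan L V)"
  unfolding fan_def
proof (intro conjI ballI)
  show "finite (chamber_fan L V)"
    using assms(2) by (rule finite_chamber_fan)
  fix C assume "C \<in> chamber_fan L V"
  then obtain x where x: "x \<in> generic L V" "C = closed_chamber L V x"
    by (auto simp: chamber_fan_def)
  have "x \<in> C"
    using x mem_chamber_self chamber_subset_closed_chamber by blast
  then show "polyhedral_cone C"
    using assms x(2) by (auto simp: polyhedral_cone_def polyhedron_closed_chamber cone_closed_chamber)
  fix C' assume "C' \<in> chamber_fan L V"
  then obtain y where y: "y \<in> generic L V" "C' = closed_chamber L V y"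
    by (auto simp: chamber_fan_def)
  show "(C \<inter> C') face_of C"
    using x y assms by (simp add: closed_chamber_Int_face_of)
  show "span C = span C'"
    using x y assms by (simp add: span_closed_chamber)
qed

section \<open>Cutting a chamber fan along a hyperplane\<close>

text \<open>A chamber is open in \<open>L\<close>, so a small step from \<open>z\<close> in the direction \<open>- u\<close> stays inside it.\<close>

lemma chamber_meets_open_halfspace:
  assumes "subspace L" "finite V" "u \<in> L" "u \<noteq> 0"
    and z: "z \<in> chamber L V x" "u \<bullet> z \<le> 0"
  obtains y where "y \<in> chamber L V x" "u \<bullet> y < 0"
proof -
  obtain e where e: "e > 0" "ball z e \<inter> L \<subseteq> chamber L V x"
    using openin_chamber[OF assms(2), of L x] z(1) unfolding openin_contains_ball by blast
  define y where "y = z - (e / (2 * norm u)) *\<^sub>R u"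
  have "dist z y = e / 2"
    using e(1) assms(4) by (simp add: y_def dist_norm)
  moreover have "y \<in> L"
    using assms z(1) by (auto simp: y_def chamber_def intro!: subspace_diff subspace_scale)
  ultimately have "y \<in> chamber L V x"
    using e by auto
  moreover have "0 < (e / (2 * norm u)) * (u \<bullet> u)"
    using e(1) assms(4) by simp
  then have "u \<bullet> y < 0"
    using z(2) by (simp add: y_def inner_diff_right)
  ultimately show thesis
    using that by blast
qed

lemma generic_nonempty:
  assumes "subspace L" "finite V" "\<And>v. v \<in> V \<Longrightarrow> v \<in> L \<and> v \<noteq> 0"
  shows "generic L V \<noteq> {}"
  using assms(2,3)
proof (induction V rule: finite_induct)
  case empty
  then show ?case
    using subspace_0[OF assms(1)] by (auto simp: generic_def)
next
  case (insert u V)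
  then obtain x where x: "x \<in> generic L V"
    by auto
  have "\<exists>y\<in>generic L V. u \<bullet> y \<noteq> 0"
  proof (cases "u \<bullet> x = 0")
    case True
    then obtain y where "y \<in> chamber L V x" "u \<bullet> y < 0"
      using chamber_meets_open_halfspace[OF assms(1) insert.hyps(1), of u x x]
        mem_chamber_self[OF x] insert.prems by auto
    then show ?thesis
      using chamber_subset_generic by (metis less_irrefl subsetD)
  qed (use x in auto)
  then show ?case
    by (auto simp: generic_def)
qed

text \<open>A chamber that meets \<open>S\<close> is the chamber around any of its points in \<open>S\<close>. So the operation
  \<open>\<inter> S\<close> on fans runs over the generic points of \<open>S\<close>.\<close>

lemma fan_inter_chamber_fan:
  fixes L :: "(real^'d) set"
  assumes "subspace L" "finite V"
  shows "fan_inter (chamber_fan L V) S = (\<lambda>z. closed_chamber L V z \<inter> S) ` (generic L V \<inter> S)"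
proof (intro equalityI subsetI)
  fix D
  assume "D \<in> fan_inter (chamber_fan L V) S"
  then obtain x where x: "x \<in> generic L V" "D = closed_chamber L V x \<inter> S"
      "rel_interior (closed_chamber L V x) \<inter> S \<noteq> {}"
    unfolding fan_inter_def chamber_fan_def by blast
  then obtain z where z: "z \<in> chamber L V x" "z \<in> S"
    using rel_interior_closed_chamber[OF assms x(1)] by blast
  have "D = closed_chamber L V z \<inter> S"
    using x(2) closed_chamber_eq[OF z(1)] by simp
  then show "D \<in> (\<lambda>z. closed_chamber L V z \<inter> S) ` (generic L V \<inter> S)"
    using z chamber_subset_generic by blast
next
  fix D
  assume "D \<in> (\<lambda>z. closed_chamber L V z \<inter> S) ` (generic L V \<inter> S)"
  then obtain z where z: "z \<in> generic L V" "z \<in> S" "D = closed_chamber L V z \<inter> S"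
    by blast
  have "z \<in> rel_interior (closed_chamber L V z)"
    using mem_chamber_self[OF z(1)] rel_interior_closed_chamber[OF assms z(1)] by simp
  then show "D \<in> fan_inter (chamber_fan L V) S"
    using z unfolding fan_inter_def chamber_fan_def by blast
qed

text \<open>A chamber of \<open>V\<close> that meets the closed halfspace also meets the open one, and around a point
  with \<open>u \<bullet> z < 0\<close> the inequality for \<open>u\<close> is the one that defines the halfspace.\<close>

lemma fan_inter_halfspace:
  fixes L :: "(real^'d) set"
  assumes L: "subspace L" and V: "finite V" and u: "u \<in> L" "u \<noteq> 0"
  shows "fan_inter (chamber_fan L V) {x \<in> L. u \<bullet> x \<le> 0}
       = fan_inter (chamber_fan L (insert u V)) {x \<in> L. u \<bullet> x \<le> 0}"
proof -
  let ?S = "{x \<in> L. u \<bullet> x \<le> 0}" and ?V = "insert u V"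
  have cut: "closed_chamber L ?V z \<inter> ?S = closed_chamber L V z \<inter> ?S" if "u \<bullet> z < 0" for z
    using that by (auto simp: closed_chamber_insert zero_le_mult_iff)
  have generic: "z \<in> generic L ?V \<inter> ?S \<longleftrightarrow> z \<in> generic L V \<and> u \<bullet> z < 0" for z
    by (auto simp: generic_def)
  have "\<exists>y\<in>generic L ?V \<inter> ?S. closed_chamber L V z \<inter> ?S = closed_chamber L ?V y \<inter> ?S"
    if z: "z \<in> generic L V" "u \<bullet> z \<le> 0" for z
  proof -
    obtain y where y: "y \<in> chamber L V z" "u \<bullet> y < 0"
      using chamber_meets_open_halfspace[OF L V u mem_chamber_self[OF z(1)] z(2)] .
    then have "y \<in> generic L ?V \<inter> ?S"
      using generic chamber_subset_generic by blast
    moreover have "closed_chamber L V z \<inter> ?S = closed_chamber L ?V y \<inter> ?S"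
      using cut[OF y(2)] closed_chamber_eq[OF y(1)] by simp
    ultimately show ?thesis
      by blast
  qed
  then have "(\<lambda>z. closed_chamber L V z \<inter> ?S) ` (generic L V \<inter> ?S)
      \<subseteq> (\<lambda>z. closed_chamber L ?V z \<inter> ?S) ` (generic L ?V \<inter> ?S)"
    by blast
  moreover have "(\<lambda>z. closed_chamber L ?V z \<inter> ?S) ` (generic L ?V \<inter> ?S)
      \<subseteq> (\<lambda>z. closed_chamber L V z \<inter> ?S) ` (generic L V \<inter> ?S)"
  proof (rule image_subsetI)
    fix z assume z: "z \<in> generic L ?V \<inter> ?S"
    then have "z \<in> generic L V \<inter> ?S" "u \<bullet> z < 0"
      using generic by blast+
    then show "closed_chamber L ?V z \<inter> ?S \<in> (\<lambda>z. closed_chamber L V z \<inter> ?S) ` (generic L V \<inter> ?S)"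
      using cut by (intro image_eqI[where x = z]) auto
  qed
  ultimately show ?thesis
    using L V by (simp add: fan_inter_chamber_fan)
qed

lemma fan_inter_hyperplane:
  fixes L :: "(real^'d) set"
  assumes "subspace L" "finite V"
  shows "fan_inter (chamber_fan L V) {x \<in> L. u \<bullet> x = 0} = chamber_fan {x \<in> L. u \<bullet> x = 0} V"
    (is "_ = chamber_fan ?H V")
proof -
  have "generic L V \<inter> ?H = generic ?H V"
    by (auto simp: generic_def)
  moreover have "closed_chamber L V z \<inter> ?H = closed_chamber ?H V z" for z
    by (auto simp: closed_chamber_def)
  ultimately show ?thesis
    unfolding fan_inter_chamber_fan[OF assms] by (simp add: chamber_fan_def)
qed

lemma fan_inter_wall:
  fixes L :: "(real^'d) set"
  assumes "subspace L" "finite V" "u \<in> V"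
  shows "fan_inter (chamber_fan L V) {x \<in> L. u \<bullet> x = 0} = {}"
proof -
  have "generic L V \<inter> {x \<in> L. u \<bullet> x = 0} = {}"
    using assms(3) by (auto simp: generic_def)
  then show ?thesis
    using assms by (simp add: fan_inter_chamber_fan)
qed

text \<open>Deletion-restriction for a set of normals: the valuation property along \<open>u\<close> is applied to the
  fans of \<open>insert u V\<close> and of \<open>V\<close>, whose parts in the two halfspaces coincide.\<close>

lemma fan_valuation_chamber_fan_insert:
  fixes \<phi> :: "(real^'d) set set \<Rightarrow> 'g::ab_group_add"
  assumes \<phi>: "fan_valuation \<phi>" and L: "subspace L" and V: "finite V"
    and VL: "\<And>v. v \<in> insert u V \<Longrightarrow> v \<in> L \<and> v \<noteq> 0"
    and H: "hyperplane_of L H" "H = {x \<in> L. u \<bullet> x = 0}"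
  shows "\<phi> (chamber_fan L (insert u V)) = \<phi> (chamber_fan L V) + \<phi> (chamber_fan H V)"
proof -
  have u: "u \<in> L" "u \<noteq> 0"
    using VL by auto
  have cut: "\<phi> (chamber_fan L W)
      = \<phi> (fan_inter (chamber_fan L W) {x \<in> L. u \<bullet> x \<le> 0})
      + \<phi> (fan_inter (chamber_fan L W) {x \<in> L. u \<bullet> x \<ge> 0})
      - \<phi> (fan_inter (chamber_fan L W) H)"
    if W: "finite W" "\<And>v. v \<in> W \<Longrightarrow> v \<in> L \<and> v \<noteq> 0" for W
  proof -
    obtain x where x: "x \<in> generic L W"
      using generic_nonempty[OF L W] by blast
    then have mem: "closed_chamber L W x \<in> chamber_fan L W"
      by (simp add: chamber_fan_def)
    have "fan (chamber_fan L W)"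
      using L W(1) by (rule fan_chamber_fan)
    moreover have "lin_fan (chamber_fan L W) = L"
      using lin_fan_eq[OF calculation mem] span_closed_chamber[OF L W(1) x] by simp
    ultimately show ?thesis
      using \<phi>[unfolded fan_valuation_def, THEN conjunct2, rule_format, of "chamber_fan L W" H u]
        mem H u(1) by auto
  qed
  have le: "fan_inter (chamber_fan L V) {x \<in> L. u \<bullet> x \<le> 0}
      = fan_inter (chamber_fan L (insert u V)) {x \<in> L. u \<bullet> x \<le> 0}"
    using L V u by (rule fan_inter_halfspace)
  have "chamber_fan L (insert (- u) V) = chamber_fan L (insert u V)"
    by (simp add: chamber_fan_def generic_def closed_chamber_def)
  \<comment> \<open>The other halfspace is the first one for the opposite normal.\<close>
  then have ge: "fan_inter (chamber_fan L V) {x \<in> L. u \<bullet> x \<ge> 0}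
      = fan_inter (chamber_fan L (insert u V)) {x \<in> L. u \<bullet> x \<ge> 0}"
    using fan_inter_halfspace[OF L V, of "- u"] L u by (simp add: subspace_neg)
  have "fan_inter (chamber_fan L V) H = chamber_fan H V"
    using fan_inter_hyperplane[OF L V] H(2) by simp
  moreover have "\<phi> (fan_inter (chamber_fan L (insert u V)) H) = 0"
    using fan_inter_wall[of L "insert u V" u] L V H(2) \<phi> by (simp add: fan_valuation_def)
  ultimately show ?thesis
    using cut[of V] cut[of "insert u V"] VL V le ge by (simp add: algebra_simps)
qed

section \<open>Deletion and restriction\<close>

lemma hyperplane_of_normal:
  assumes L: "subspace L" and H: "hyperplane_of L H"
  obtains u where "u \<in> L" "u \<noteq> 0" "H = {x \<in> L. u \<bullet> x = 0}"
proof -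
  have sH: "subspace H" "H \<subseteq> L" "dim L = dim H + 1"
    using H by (auto simp: hyperplane_of_def)
  then have "span H \<subset> span L"
    using L span_eq_iff by (metis add_cancel_left_right psubsetI zero_neq_one)
  then obtain u where u: "u \<noteq> 0" "u \<in> span L" "\<And>y. y \<in> span H \<Longrightarrow> orthogonal u y"
    using orthogonal_to_subspace_exists_gen by blast
  let ?K = "{x \<in> L. u \<bullet> x = 0}"
  have uL: "u \<in> L"
    using u(2) L by (simp add: span_eq_iff[THEN iffD2])
  have K: "subspace ?K"
    using L by (auto simp: subspace_def inner_add_right)
  have "H \<subseteq> ?K"
    using sH(2) u(3) by (auto simp: orthogonal_def span_base)
  moreover have "u \<in> L - ?K"
    using u(1) uL by simp
  then have "?K \<subset> L"
    by blast
  then have "span ?K \<subset> span L"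
    using K L by (simp add: span_eq_iff[THEN iffD2])
  then have "dim ?K < dim L"
    by (rule dim_psubset)
  ultimately have "H = ?K"
    using sH K by (intro subspace_dim_equal) auto
  then show thesis
    using that u(1) uL by blast
qed

lemma arrangement_fan_eq_chamber_fan:
  assumes "subspace L" "finite V" "L - \<Union>A = generic L V"
  shows "arrangement_fan L A = chamber_fan L V"
  using closure_components_generic[OF assms(1,2)] assms(3) by (simp add: arrangement_fan_def)

theorem proposition2p2:
  fixes \<phi> :: "(real^'d) set set \<Rightarrow> 'g::ab_group_add"
    and L :: "(real^'d) set"
    and A :: "(real^'d) set set"
    and H :: "(real^'d) set"
  assumes "fan_valuation \<phi>"
    and "arrangement L A"
    and "\<not> is_singleton A"
    and "H \<in> A"
  shows "\<phi> (arrangement_fan L A)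
       = \<phi> (arrangement_fan L (deletion A H)) + \<phi> (arrangement_fan H (restriction A H))"
proof -
  have L: "subspace L" and A: "finite A" "\<And>K. K \<in> A \<Longrightarrow> hyperplane_of L K"
    using assms(2) by (auto simp: arrangement_def)
  have "\<exists>v. v \<in> L \<and> v \<noteq> 0 \<and> K = {x \<in> L. v \<bullet> x = 0}" if "K \<in> A" for K
    using hyperplane_of_normal[OF L A(2)[OF that]] by metis
  then obtain n where n: "n K \<in> L" "n K \<noteq> 0" "K = {x \<in> L. n K \<bullet> x = 0}" if "K \<in> A" for K
    by metis
  have wall: "x \<in> K \<longleftrightarrow> x \<in> L \<and> n K \<bullet> x = 0" if "K \<in> A" for x K
    using n(3)[OF that] by blast
  let ?V = "n ` deletion A H"
  have V: "finite ?V"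
    using A(1) by (simp add: deletion_def)
  have H: "hyperplane_of L H" "subspace H" "H \<subseteq> L"
    using A(2)[OF assms(4)] by (auto simp: hyperplane_of_def)
  have "L - \<Union>A = generic L (insert (n H) ?V)"
    using assms(4) wall by (auto simp: generic_def deletion_def)
  then have "arrangement_fan L A = chamber_fan L (insert (n H) ?V)"
    using L V by (intro arrangement_fan_eq_chamber_fan) auto
  moreover have del: "L - \<Union>(deletion A H) = generic L ?V"
    using wall by (auto simp: generic_def deletion_def)
  then have "arrangement_fan L (deletion A H) = chamber_fan L ?V"
    using L V by (intro arrangement_fan_eq_chamber_fan)
  moreover have "H - \<Union>(restriction A H) = H \<inter> (L - \<Union>(deletion A H))"
    using H(3) by (auto simp: deletion_def restriction_def)
  then have "H - \<Union>(restriction A H) = generic H ?V"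
    unfolding del using H(3) by (auto simp: generic_def)
  then have "arrangement_fan H (restriction A H) = chamber_fan H ?V"
    using H(2) V by (intro arrangement_fan_eq_chamber_fan)
  moreover have "\<phi> (chamber_fan L (insert (n H) ?V)) = \<phi> (chamber_fan L ?V) + \<phi> (chamber_fan H ?V)"
    using n assms(4) by (intro fan_valuation_chamber_fan_insert[OF assms(1) L V _ H(1)])
      (auto simp: deletion_def)
  ultimately show ?thesis
    by simp
qed

end
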